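(* For every integer $a\geq 2$, $\mathrm{g}(S(a))=\frac{a}{5}\left(l_a+l_{a-2}\right)$.
   Context: $\mathbb{N}=\{0,1,2,\ldots\}$. The Lucas series $\{l_n\}_{n\in\mathbb{N}}$ is defined by $l_0=2$, $l_1=1$, $l_{n+2}=l_{n+1}+l_n$. For $a\in\mathbb{N}$, $S(a)$ is the submonoid of $(\mathbb{N},+)$ generated by $\{l_a\}\cup\{l_a+l_n\mid n\in\mathbb{N}\}$; it is a numerical semigroup, i.e. $\mathbb{N}\setminus S(a)$ is finite. The genus $\mathrm{g}(S)$ of a numerical semigroup $S$ is the cardinality of $\mathbb{N}\setminus S$. *)

theory Defs
  imports Complex_Main
begin

fun lucas :: "nat \<Rightarrow> nat" where
  "lucas 0 = 2"
| "lucas (Suc 0) = 1"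
| "lucas (Suc (Suc n)) = lucas (Suc n) + lucas n"

definition is_submonoid :: "nat set \<Rightarrow> bool" where
  "is_submonoid M \<longleftrightarrow> 0 \<in> M \<and> (\<forall>x\<in>M. \<forall>y\<in>M. x + y \<in> M)"

definition S :: "nat \<Rightarrow> nat set" where
  "S a = is_submonoid hull ({lucas a} \<union> {lucas a + lucas n | n. True})"

text \<open>
  The genus is meaningful for numerical semigroups, i.e. when the complement is finite;
  for an infinite complement \<^const>\<open>card\<close> yields 0, so an equation asserting a positive
  genus also entails that the complement is finite.
\<close>
definition genus :: "nat set \<Rightarrow> nat" where
  "genus M = card (UNIV - M)"

end

theory Submission
  imports Defs
begin

text \<open>
  Write \<open>l\<close> for the Lucas numbers and \<open>G x\<close> for the number of terms in the greedy
  decomposition of \<open>x\<close> into Lucas numbers. Then \<open>n \<in> S(a)\<close> iff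
  \<open>G (n mod l\<^sub>a) \<le> n div l\<^sub>a\<close>, so the genus is the sum of \<open>G i\<close> over \<open>i < l\<^sub>a\<close>; splitting
  this sum at \<open>l\<^sub>a\<^sub>-\<^sub>1\<close> yields a linear recurrence for it.
  That the right-hand condition is preserved by adding a generator rests on two facts about
  greedy decompositions: \<open>G (x + l\<^sub>n) \<le> G x + 1\<close>, and \<open>G (x + l\<^sub>n - l\<^sub>b) \<le> G x\<close> whenever
  \<open>n < b\<close> and \<open>x < l\<^sub>b \<le> x + l\<^sub>n\<close>. They are proved by a simultaneous induction on \<open>x\<close>.
  Only generators with \<open>n < a\<close> need this: for \<open>n \<ge> a\<close>, \<open>l\<^sub>n\<close> is itself a sum of copies of
  \<open>l\<^sub>a\<close> and \<open>l\<^sub>a + l\<^sub>a\<^sub>-\<^sub>1\<close>.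
\<close>

section \<open>Lucas numbers\<close>

lemma lucas_pos: "0 < lucas n"
  by (induction n rule: lucas.induct) auto

lemma lucas_less_Suc: "1 \<le> n \<Longrightarrow> lucas n < lucas (Suc n)"
  by (cases n) (simp_all add: lucas_pos)

lemma lucas_less:
  assumes "1 \<le> m" "m < n"
  shows "lucas m < lucas n"
  using assms(2,1)
proof (induction rule: strict_inc_induct)
  case (base i)
  then show ?case by (simp add: lucas_less_Suc)
next
  case (step i)
  then show ?case using lucas_less_Suc[of i] by simp
qed

lemma lucas_mono: "1 \<le> m \<Longrightarrow> m \<le> n \<Longrightarrow> lucas m \<le> lucas n"
  using lucas_less[of m n] by (cases "m = n") auto

text \<open>Index 0 is out of order, since l_0 = 2 exceeds l_1 = 1; from l_2 = 3 on, every earlier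
  value is smaller.\<close>

lemma lucas_less_of_ge_2:
  assumes "m < n" "2 \<le> n"
  shows "lucas m < lucas n"
proof (cases "m = 0")
  case True
  then show ?thesis
    using lucas_mono[of 2 n] assms by (simp add: numeral_2_eq_2)
next
  case False
  then show ?thesis using lucas_less assms by simp
qed

lemma less_lucas_Suc: "n < lucas (Suc n)"
proof (induction n)
  case (Suc n)
  then show ?case using lucas_less_Suc[of "Suc n"] by linarith
qed simp

lemma lucas_bracket:
  assumes "1 \<le> m" "lucas m \<le> x"
  obtains n where "m \<le> n" "lucas n \<le> x" "x < lucas (Suc n)"
proof -
  define n where "n = (LEAST n. x < lucas (Suc n))"
  have n: "x < lucas (Suc n)"
    unfolding n_def by (rule LeastI) (rule less_lucas_Suc)
  have "m \<le> n"
    using lucas_mono[of "Suc n" m] n assms(2) by (cases "m \<le> n") auto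
  moreover have "lucas n \<le> x"
  proof -
    obtain k where k: "n = Suc k" using \<open>m \<le> n\<close> assms(1) by (cases n) auto
    have "\<not> x < lucas (Suc k)"
      using not_less_Least[of k "\<lambda>n. x < lucas (Suc n)"] k
      by (simp only: n_def[symmetric] lessI simp_thms)
    then show ?thesis using k by simp
  qed
  ultimately show ?thesis using that n by blast
qed

section \<open>Greedy decompositions\<close>

definition greedy_part :: "nat \<Rightarrow> nat" where
  "greedy_part x = Max {lucas m | m. lucas m \<le> x}"

lemma greedy_part_eqI:
  assumes "lucas n \<le> x" "\<And>m. lucas m \<le> x \<Longrightarrow> lucas m \<le> lucas n"
  shows "greedy_part x = lucas n"
  unfolding greedy_part_def
proof (rule Max_eqI)
  show "finite {lucas m |m. lucas m \<le> x}"
    by (rule finite_subset[of _ "{..x}"]) auto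
qed (use assms in auto)

lemma greedy_part_obtain:
  assumes "0 < x"
  obtains n where "greedy_part x = lucas n" "lucas n \<le> x"
proof -
  have "finite {lucas m |m. lucas m \<le> x}"
    by (rule finite_subset[of _ "{..x}"]) auto
  moreover have "lucas 1 \<in> {lucas m |m. lucas m \<le> x}"
    using assms by (intro CollectI exI[of _ 1]) auto
  ultimately have "greedy_part x \<in> {lucas m |m. lucas m \<le> x}"
    unfolding greedy_part_def using Max_in by blast
  then show ?thesis using that by auto
qed

function greedy_length :: "nat \<Rightarrow> nat" where
  "greedy_length x = (if x = 0 then 0 else Suc (greedy_length (x - greedy_part x)))"
  by auto
termination
proof (relation "measure id")
  fix x :: nat
  assume "x \<noteq> 0"
  then obtain n where "greedy_part x = lucas n" "lucas n \<le> x"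
    using greedy_part_obtain by blast
  then show "(x - greedy_part x, x) \<in> measure id"
    using lucas_pos[of n] \<open>x \<noteq> 0\<close> by simp
qed simp

declare greedy_length.simps [simp del]

lemma greedy_length_0 [simp]: "greedy_length 0 = 0"
  by (simp add: greedy_length.simps)

lemma greedy_length_pos: "0 < x \<Longrightarrow> 0 < greedy_length x"
  by (subst greedy_length.simps) simp

text \<open>The bound on \<open>r\<close> keeps the sum below l_(j+3), so l_(j+2) is its greedy
  part. Index 1 must be excluded: 1 + 1 is the single part l_0.\<close>

lemma greedy_length_add:
  assumes "r < lucas (Suc j)"
  shows "greedy_length (lucas (Suc (Suc j)) + r) = Suc (greedy_length r)"
proof -
  have "greedy_part (lucas (Suc (Suc j)) + r) = lucas (Suc (Suc j))"
  proof (rule greedy_part_eqI)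
    fix m assume m: "lucas m \<le> lucas (Suc (Suc j)) + r"
    have "m \<le> Suc (Suc j)"
    proof (rule ccontr)
      assume "\<not> ?thesis"
      then have "lucas (Suc (Suc (Suc j))) \<le> lucas m" by (intro lucas_mono) auto
      then show False using m assms by simp
    qed
    then show "lucas m \<le> lucas (Suc (Suc j))"
      using lucas_less_of_ge_2[of m "Suc (Suc j)"] by (cases "m = Suc (Suc j)") auto
  qed simp
  then show ?thesis
    using lucas_pos[of "Suc (Suc j)"]
    by (subst greedy_length.simps) (simp del: lucas.simps)
qed

lemma greedy_length_lucas: "greedy_length (lucas n) = 1"
proof -
  have "greedy_part (lucas n) = lucas n"
    by (rule greedy_part_eqI) auto
  then show ?thesis
    using lucas_pos[of n] by (subst greedy_length.simps) simp
qed

text \<open>For x < 4 and n < 4 the sum x + l_n is at most 7, so this table settles the base case.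
  Only 5 = 4 + 1 and 6 = 4 + 2 need two parts.\<close>

lemma greedy_length_small:
  "greedy_length (Suc 0) = 1" "greedy_length 2 = 1" "greedy_length 3 = 1"
  "greedy_length 4 = 1" "greedy_length 5 = 2" "greedy_length 6 = 2" "greedy_length 7 = 1"
  using greedy_length_lucas[of 1] greedy_length_lucas[of 0] greedy_length_lucas[of 2]
    greedy_length_lucas[of 3] greedy_length_lucas[of 4]
    greedy_length_add[of 1 1] greedy_length_add[of 2 1]
  by (simp_all add: eval_nat_numeral)

lemma nat_less_4_cases:
  fixes x :: nat
  assumes "x < 4"
  obtains "x = 0" | "x = 1" | "x = 2" | "x = 3"
  using assms by linarith

lemma greedy_length_small_le:
  assumes "x < 4"
  shows "greedy_length x \<le> 1"
  using assms by (rule nat_less_4_cases) (simp_all add: greedy_length_small)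

lemma greedy_length_add_lucas_small:
  assumes "x < 4"
  shows "greedy_length (x + lucas n) \<le> Suc (greedy_length x)"
proof (cases "n < 4")
  case True
  have l: "lucas 2 = 3" "lucas 3 = 4"
    by (simp_all add: eval_nat_numeral)
  show ?thesis
    by (rule nat_less_4_cases[OF True]; rule nat_less_4_cases[OF assms])
      (simp_all add: greedy_length_small l flip: numeral_2_eq_2 numeral_3_eq_3)
next
  case False
  then have "4 \<le> n" by simp
  obtain j where j: "n = Suc (Suc (Suc (Suc j)))"
    using le_Suc_ex[OF \<open>4 \<le> n\<close>] by (auto simp: numeral_eq_Suc)
  have "lucas 3 \<le> lucas (Suc (Suc (Suc j)))" by (rule lucas_mono) auto
  then have "x < lucas (Suc (Suc (Suc j)))"
    using assms by (simp add: numeral_3_eq_3)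
  then show ?thesis
    using greedy_length_add[of x "Suc (Suc j)"] by (simp add: j add.commute)
qed

text \<open>Removing the greedy part l_m of x leaves r < l_(m-1), and both claims reduce to claims
  about r. Each needs the other: adding l_n to r may carry past l_(m-1), which the second claim
  controls, while b = m + 1, n = m in the second claim calls for the first.\<close>

lemma greedy_length_lucas_shift:
  "(\<forall>n. greedy_length (x + lucas n) \<le> Suc (greedy_length x)) \<and>
   (\<forall>b n. 2 \<le> b \<longrightarrow> n < b \<longrightarrow> x < lucas b \<longrightarrow> lucas b \<le> x + lucas n \<longrightarrow>
      greedy_length (x + lucas n - lucas b) \<le> greedy_length x)"
proof (induction x rule: less_induct)
  case (less x)
  show ?case
  proof (cases "x < 4")
    case True
    have "greedy_length (x + lucas n - lucas b) \<le> greedy_length x"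
      if "2 \<le> b" "n < b" "x < lucas b" "lucas b \<le> x + lucas n" for b n
    proof -
      have lt: "lucas n < lucas b" using lucas_less_of_ge_2 that by blast
      then have "0 < x" using that by linarith
      \<comment> \<open>The difference is smaller than x, hence below 4, where every positive number
        is a Lucas number.\<close>
      have "greedy_length (x + lucas n - lucas b) \<le> 1"
        using greedy_length_small_le lt True by simp
      then show ?thesis using greedy_length_pos[OF \<open>0 < x\<close>] by linarith
    qed
    then show ?thesis using greedy_length_add_lucas_small[OF True] by blast
  next
    case False
    then have "lucas 3 \<le> x" by (simp add: numeral_3_eq_3)
    then obtain m where m: "3 \<le> m" "lucas m \<le> x" "x < lucas (Suc m)"
      by (rule lucas_bracket[rotated]) auto
    obtain k where k: "m = Suc (Suc (Suc k))"
      using le_Suc_ex[OF m(1)] by (auto simp: numeral_3_eq_3)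
    define r where "r = x - lucas m"
    have x: "x = lucas (Suc (Suc (Suc k))) + r"
      using m k by (simp add: r_def)
    have r: "r < lucas (Suc (Suc k))"
      using m k x by simp
    have "r < x" using x lucas_pos[of "Suc (Suc (Suc k))"] by linarith
    note IH = less.IH[OF this]
    have A: "greedy_length (r + lucas n) \<le> Suc (greedy_length r)" for n
      using IH by blast
    \<comment> \<open>The second claim for r at b = m - 1 = k + 2; the requirement b \<ge> 2 is why
      the base case runs up to l_3 = 4.\<close>
    have B: "greedy_length (r + lucas n - lucas (Suc (Suc k))) \<le> greedy_length r"
      if "n \<le> Suc k" "lucas (Suc (Suc k)) \<le> r + lucas n" for n
      using IH that r by (metis Suc_le_mono le_imp_less_Suc numeral_2_eq_2 zero_le)
    have Gx: "greedy_length x = Suc (greedy_length r)"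
      unfolding x by (rule greedy_length_add) (rule r)
    have inc: "lucas (Suc k) < lucas (Suc (Suc k))"
      by (rule lucas_less_Suc) simp
    have "greedy_length (x + lucas n) \<le> Suc (greedy_length x)" for n
    proof -
      \<comment> \<open>In turn: l_n becomes the greedy part; l_m + l_(m+1) = l_(m+2); 2 l_m =
        l_(m+1) + l_(m-2); l_m + l_(m-1) = l_(m+1); and l_n is added to r.\<close>
      consider (large) "Suc (Suc m) \<le> n" | (s) "n = Suc m" | (e) "n = m" | (p) "n = Suc (Suc k)"
        | (small) "n \<le> Suc k"
        using k by linarith
      then show ?thesis
      proof cases
        case large
        then obtain d where d: "n = Suc (Suc d)" "m \<le> d"
          by (metis Suc_le_D Suc_le_mono)
        have "lucas (Suc m) \<le> lucas (Suc d)" by (rule lucas_mono) (use d in auto)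
        then have "x < lucas (Suc d)" using m by linarith
        then show ?thesis using greedy_length_add[of x d] d by (simp add: add.commute)
      next
        case s
        have "x + lucas n = lucas (Suc (Suc (Suc (Suc (Suc k))))) + r"
          using x s k by simp
        moreover have "r < lucas (Suc (Suc (Suc (Suc k))))" using r by simp
        ultimately show ?thesis using greedy_length_add[of r] Gx by (simp del: lucas.simps)
      next
        case e
        have "x + lucas n = lucas (Suc (Suc (Suc (Suc k)))) + (r + lucas (Suc k))"
          using x e k by simp
        moreover have "r + lucas (Suc k) < lucas (Suc (Suc (Suc k)))" using r by simp
        ultimately show ?thesis
          using greedy_length_add[of "r + lucas (Suc k)"] Gx A[of "Suc k"] by (simp del: lucas.simps)
      next
        case p
        have "x + lucas n = lucas (Suc (Suc (Suc (Suc k)))) + r"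
          using x p by simp
        moreover have "r < lucas (Suc (Suc (Suc k)))" using r by simp
        ultimately show ?thesis using greedy_length_add[of r] Gx by (simp del: lucas.simps)
      next
        case small
        show ?thesis
        proof (cases "r + lucas n < lucas (Suc (Suc k))")
          case True
          then show ?thesis
            using greedy_length_add[of "r + lucas n" "Suc k"] x Gx A[of n] by (simp add: add.assoc)
        next
          case False
          \<comment> \<open>Carry: l_m absorbs l_(m-1) into l_(m+1), and \<open>y\<close> is what
            remains of r + l_n.\<close>
          define y where "y = r + lucas n - lucas (Suc (Suc k))"
          have "x + lucas n = lucas (Suc (Suc (Suc (Suc k)))) + y"
            using False x by (simp add: y_def)
          moreover have "lucas n < lucas (Suc (Suc k))"
            by (rule lucas_less_of_ge_2) (use small in auto)
          then have "y < lucas (Suc (Suc (Suc k)))" using r by (simp add: y_def)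
          ultimately show ?thesis
            using greedy_length_add[of y] Gx B[OF small] False
            by (simp add: y_def del: lucas.simps)
        qed
      qed
    qed
    moreover have "greedy_length (x + lucas n - lucas b) \<le> greedy_length x"
      if b: "2 \<le> b" "n < b" "x < lucas b" "lucas b \<le> x + lucas n" for b n
    proof -
      have "m < b"
        using lucas_mono[of b m] b m by (cases "m < b") auto
      then consider (next_) "b = Suc m" | (far) "Suc (Suc m) \<le> b" by linarith
      then show ?thesis
      proof cases
        case next_
        \<comment> \<open>Here x + l_n - l_b = r + l_n - l_(m-1), which is r + l_(m-2) for n = m and
          r for n = m - 1.\<close>
        then consider "n = m" | "n = Suc (Suc k)" | "n \<le> Suc k" using b k by linarith
        then show ?thesis
        proof cases
          case 1
          then have "x + lucas n - lucas b = r + lucas (Suc k)"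
            using x k next_ by simp
          then show ?thesis using A Gx by simp
        next
          case 2
          then have "x + lucas n - lucas b = r"
            using x k next_ by simp
          then show ?thesis using Gx by simp
        next
          case 3
          have "x + lucas n - lucas b = r + lucas n - lucas (Suc (Suc k))"
            using x k next_ by simp
          moreover have "lucas (Suc (Suc k)) \<le> r + lucas n"
            using b x k next_ by simp
          ultimately show ?thesis using B[OF 3] Gx by simp
        qed
      next
        case far
        then obtain d where d: "b = Suc (Suc d)" "m \<le> d"
          by (metis Suc_le_D Suc_le_mono)
        have "lucas (Suc m) \<le> lucas (Suc d)" by (rule lucas_mono) (use d in auto)
        then have xd: "x < lucas (Suc d)" using m by linarith
        \<comment> \<open>Size alone leaves only n = m + 1, b = m + 2: a smaller n gives x + l_n <
          l_(d+1) + l_d = l_b, and then l_d \<le> x forces d = m.\<close>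
        have "n = Suc d"
        proof (rule ccontr)
          assume "n \<noteq> Suc d"
          then have "n \<le> d" using b d by linarith
          then have "lucas n \<le> lucas d"
            using lucas_less_of_ge_2[of n d] d m by (cases "n = d") auto
          then show False using b d xd by simp
        qed
        then have ld: "lucas d \<le> x" using b d by simp
        have "d = m"
        proof (rule ccontr)
          assume "d \<noteq> m"
          then have "lucas (Suc m) \<le> lucas d" by (intro lucas_mono) (use d in auto)
          then show False using ld m by linarith
        qed
        then have "x + lucas n - lucas b = r"
          using d \<open>n = Suc d\<close> by (simp add: r_def)
        then show ?thesis using Gx by simp
      qed
    qed
    ultimately show ?thesis by blast
  qed
qed

section \<open>Summing greedy lengths below a Lucas number\<close>

lemma sum_greedy_length_lucas_rec:
  "sum greedy_length {..<lucas (Suc (Suc (Suc n)))} =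
   sum greedy_length {..<lucas (Suc (Suc n))} + sum greedy_length {..<lucas (Suc n)} + lucas (Suc n)"
proof -
  define p q where "p = lucas (Suc (Suc n))" and "q = lucas (Suc n)"
  have "sum greedy_length {..<p + q} = sum greedy_length {..<p} + (\<Sum>i<q. greedy_length (p + i))"
    by (induction q) (simp_all add: add.assoc)
  \<comment> \<open>Since p and q are consecutive Lucas numbers, every i < q costs exactly one part
    more after the shift by p.\<close>
  also have "(\<Sum>i<q. greedy_length (p + i)) = (\<Sum>i<q. Suc (greedy_length i))"
    by (intro sum.cong refl) (simp only: p_def q_def lessThan_iff greedy_length_add)
  also have "\<dots> = sum greedy_length {..<q} + q"
    by (induction q) simp_all
  finally show ?thesis by (simp add: p_def q_def)
qed

text \<open>Put c_n = l_(n+2) + l_n, which obeys the Lucas recurrence. Then (n+2) c_n obeys it up to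
  the excess 2 c_(n+2) - c_(n+1) = c_(n+2) + c_n = 5 l_(n+2), five times the extra term in the
  recurrence of the sums.\<close>

lemma sum_greedy_length_lucas:
  "5 * sum greedy_length {..<lucas (n + 2)} = (n + 2) * (lucas (n + 2) + lucas n)"
proof (induction n rule: induct_nat_012)
  case 0
  then show ?case using greedy_length_small by (simp add: eval_nat_numeral)
next
  case 1
  then show ?case using greedy_length_small by (simp add: eval_nat_numeral)
next
  case (ge2 n)
  define p q where "p = lucas (Suc n)" and "q = lucas n"
  show ?case
    using ge2 sum_greedy_length_lucas_rec[of "Suc n"]
    by (simp add: p_def[symmetric] q_def[symmetric] algebra_simps)
qed

section \<open>Membership in the semigroup\<close>

lemma is_submonoid_S: "is_submonoid (S a)"
  unfolding S_def by (rule hull_in) (auto simp: is_submonoid_def)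

lemma S_minimal:
  assumes "is_submonoid M" "lucas a \<in> M" "\<And>n. lucas a + lucas n \<in> M"
  shows "S a \<subseteq> M"
  unfolding S_def by (rule hull_minimal) (use assms in auto)

lemma lucas_in_S: "lucas a \<in> S a" "lucas a + lucas n \<in> S a"
  unfolding S_def by (rule hull_inc; auto)+

lemma S_add: "x \<in> S a \<Longrightarrow> y \<in> S a \<Longrightarrow> x + y \<in> S a"
  using is_submonoid_S by (auto simp: is_submonoid_def)

lemma mult_lucas_in_S: "k * lucas a \<in> S a"
proof (induction k)
  case 0
  then show ?case using is_submonoid_S by (auto simp: is_submonoid_def)
next
  case (Suc k)
  then show ?case using S_add[OF lucas_in_S(1)] by simp
qed

lemma mult_lucas_add_in_S: "greedy_length x \<le> k \<Longrightarrow> k * lucas a + x \<in> S a"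
proof (induction x arbitrary: k rule: less_induct)
  case (less x)
  show ?case
  proof (cases "x = 0")
    case True
    then show ?thesis using mult_lucas_in_S by simp
  next
    case False
    then obtain n where n: "greedy_part x = lucas n" "lucas n \<le> x"
      using greedy_part_obtain by blast
    have "greedy_length x = Suc (greedy_length (x - lucas n))"
      using False n by (subst greedy_length.simps) simp
    then obtain j where j: "k = Suc j" "greedy_length (x - lucas n) \<le> j"
      using less.prems by (cases k) auto
    have "j * lucas a + (x - lucas n) \<in> S a"
      using less.IH[OF _ j(2)] lucas_pos[of n] False by simp
    from S_add[OF lucas_in_S(2)[of a n] this] show ?thesis
      using n j by (simp add: algebra_simps)
  qed
qed

text \<open>The candidate for \<open>S a\<close>, given by its Apery set: the least element in the
  residue class of i < l_a is \<open>greedy_length i * lucas a + i\<close>.\<close>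

definition greedy_set :: "nat \<Rightarrow> nat set" where
  "greedy_set a = {t. greedy_length (t mod lucas a) \<le> t div lucas a}"

lemma greedy_set_add_lucas: "t \<in> greedy_set a \<Longrightarrow> lucas a + t \<in> greedy_set a"
  using lucas_pos[of a] by (simp add: greedy_set_def)

text \<open>If the remainder does not wrap around, the quotient grows by one, which pays for one
  more part. If it wraps, the quotient grows by two and, by the second shift bound with b = a, the
  length does not grow.\<close>

lemma greedy_set_add_generator:
  assumes "2 \<le> a" "n < a" "t \<in> greedy_set a"
  shows "lucas a + lucas n + t \<in> greedy_set a"
proof -
  define i q where "i = t mod lucas a" and "q = t div lucas a"
  have t: "t = q * lucas a + i" by (simp add: i_def q_def)
  have i: "i < lucas a" using lucas_pos by (simp add: i_def)
  have G: "greedy_length i \<le> q" using assms(3) by (simp add: greedy_set_def i_def q_def)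
  have n: "lucas n < lucas a" using lucas_less_of_ge_2 assms by blast
  have *: "u * lucas a + j \<in> greedy_set a" if "j < lucas a" "greedy_length j \<le> u" for u j
    using that by (simp add: greedy_set_def)
  show ?thesis
  proof (cases "i + lucas n < lucas a")
    case True
    have "greedy_length (i + lucas n) \<le> Suc q"
      using greedy_length_lucas_shift[of i] G by (meson Suc_le_mono le_trans)
    from *[OF True this] show ?thesis by (simp add: t algebra_simps)
  next
    case False
    have "greedy_length (i + lucas n - lucas a) \<le> greedy_length i"
      using greedy_length_lucas_shift[of i] False assms i by (simp add: not_less)
    then have "greedy_length (i + lucas n - lucas a) \<le> Suc (Suc q)" using G by linarith
    from *[OF _ this] have "Suc (Suc q) * lucas a + (i + lucas n - lucas a) \<in> greedy_set a"
      using i n by simp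
    also have "Suc (Suc q) * lucas a + (i + lucas n - lucas a) = lucas a + lucas n + t"
      using False by (simp add: t)
    finally show ?thesis .
  qed
qed

lemma S_eq_greedy_set:
  assumes "2 \<le> a"
  shows "S a = greedy_set a"
proof
  show "greedy_set a \<subseteq> S a"
  proof
    fix t assume "t \<in> greedy_set a"
    then show "t \<in> S a"
      using mult_lucas_add_in_S[of "t mod lucas a" "t div lucas a" a]
      by (simp add: greedy_set_def)
  qed
  \<comment> \<open>Translations preserving \<open>greedy_set a\<close> form a submonoid
    automatically, so only generators need checking; applying a translation to 0 returns to
    \<open>greedy_set a\<close>.\<close>
  define M where "M = {x. \<forall>t\<in>greedy_set a. x + t \<in> greedy_set a}"
  have add: "x + y \<in> M" if "x \<in> M" "y \<in> M" for x y
    using that by (auto simp: M_def add.assoc)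
  have sub: "is_submonoid M"
    using add by (auto simp: is_submonoid_def) (simp add: M_def)
  have la: "lucas a \<in> M"
    using greedy_set_add_lucas by (simp add: M_def)
  have small: "lucas a + lucas n \<in> M" if "n < a" for n
    using greedy_set_add_generator[OF assms that] by (simp add: M_def)
  have large: "lucas (a + d) \<in> M" for d
  proof (induction d rule: induct_nat_012)
    case 1
    obtain b where "a = Suc b" using assms by (cases a) auto
    then show ?case using small[of b] by simp
  next
    case (ge2 n)
    then show ?case using add by simp
  qed (use la in simp)
  have "lucas a + lucas n \<in> M" for n
    using small[of n] add[OF la large[of "n - a"]] by (cases "n < a") auto
  then have "S a \<subseteq> M" using S_minimal[OF sub la] by blast
  moreover have "0 \<in> greedy_set a" by (simp add: greedy_set_def)
  ultimately show "S a \<subseteq> greedy_set a"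
    by (auto simp: M_def dest!: subsetD)
qed

text \<open>Division by l_a identifies the gaps with pairs of a remainder i and a quotient below
  \<open>greedy_length i\<close>.\<close>

lemma genus_eq_sum_greedy_length:
  assumes "2 \<le> a"
  shows "genus (S a) = sum greedy_length {..<lucas a}"
proof -
  let ?D = "SIGMA i:{..<lucas a}. {..<greedy_length i}"
  have "bij_betw (\<lambda>(i, q). q * lucas a + i) ?D (UNIV - S a)"
    unfolding S_eq_greedy_set[OF assms] greedy_set_def
    by (rule bij_betw_byWitness[where f' = "\<lambda>t. (t mod lucas a, t div lucas a)"])
      (auto simp: lucas_pos)
  then have "genus (S a) = card ?D"
    unfolding genus_def by (simp add: bij_betw_same_card)
  then show ?thesis by simp
qed

theorem theorem6p7:
  fixes a :: nat
  assumes "a \<ge> 2"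
  shows "real (genus (S a)) = real a / 5 * (real (lucas a) + real (lucas (a - 2)))"
proof -
  have "5 * genus (S a) = a * (lucas a + lucas (a - 2))"
    using sum_greedy_length_lucas[of "a - 2"]
    by (simp only: genus_eq_sum_greedy_length[OF assms] le_add_diff_inverse2[OF assms])
  then have "real (5 * genus (S a)) = real (a * (lucas a + lucas (a - 2)))"
    by (simp only:)
  then show ?thesis by simp
qed

end
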